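(* Let $n\ge 1$. A subset $W\subset (\mathbb{R}_{\max}^n)^2$ is the polar of a max-plus convex cone, i.e. $W=V^\circ$ for some max-plus convex cone $V\subset\mathbb{R}_{\max}^n$, if and only if the following conditions are satisfied: (i) $W$ is a closed max-plus convex cone (as a subset of $(\mathbb{R}_{\max}^n)^2\cong\mathbb{R}_{\max}^{2n}$); (ii) for all $f,g\in\mathbb{R}_{\max}^n$, $f\leq g$ implies $(f,g)\in W$; (iii) for all $f,g,h\in\mathbb{R}_{\max}^n$, $(f,g)\in W$ and $(g,h)\in W$ imply $(f,h)\in W$.
   Context: $\mathbb{R}_{\max}$ is the max-plus semiring: the set $\mathbb{R}\cup\{-\infty\}$ with addition $a\oplus b=\max(a,b)$ and multiplication $a\otimes b=a+b$ (with $-\infty$ absorbing for $\otimes$). Vectors are ordered entrywise, for the usual order on $\mathbb{R}\cup\{-\infty\}$. The topology on $\mathbb{R}_{\max}$ is given by the metric $d(a,b)=|\exp(a)-\exp(b)|$ (with $\exp(-\infty)=0$), and products carry the product topology. A max-plus convex cone (semimodule) in $\mathbb{R}_{\max}^m$ is a subset $V$ such that $\max(\lambda+x,\mu+y)\in V$ for all $x,y\in V$ and $\lambda,\mu\in\mathbb{R}_{\max}$, where $\lambda+x$ is the vector with entries $\lambda+x_i$ and the max is entrywise. The polar of a max-plus convex cone $V\subset\mathbb{R}_{\max}^n$ is $$V^\circ=\{(f,g)\in(\mathbb{R}_{\max}^n)^2 \mid \max_i(f_i+x_i)\leq\max_j(g_j+x_j)\ \ \forall x\in V\}.$$ *)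

theory Defs
  imports "HOL-Analysis.Analysis"
begin

section \<open>The max-plus semiring\<close>

datatype rmax = MInfty | Fin real

text \<open>
  The exponential \<open>\<real>\<^sub>m\<^sub>a\<^sub>x \<rightarrow> [0, \<infinity>)\<close>, with \<open>exp (-\<infinity>) = 0\<close>.
\<close>

fun rexp :: "rmax \<Rightarrow> real" where
  "rexp MInfty = 0"
| "rexp (Fin a) = exp a"

lemma rexp_inj: "rexp x = rexp y \<longleftrightarrow> x = y"
  by (cases x; cases y) auto

lemma rexp_nonneg: "0 \<le> rexp x"
  by (cases x) auto

instantiation rmax :: linorder
begin

fun less_eq_rmax :: "rmax \<Rightarrow> rmax \<Rightarrow> bool" where
  "MInfty \<le> y \<longleftrightarrow> True"
| "Fin a \<le> MInfty \<longleftrightarrow> False"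
| "Fin a \<le> Fin b \<longleftrightarrow> a \<le> b"

definition less_rmax :: "rmax \<Rightarrow> rmax \<Rightarrow> bool" where
  "x < y \<longleftrightarrow> x \<le> y \<and> \<not> y \<le> (x :: rmax)"

lemma less_eq_rmax_iff_rexp: "x \<le> y \<longleftrightarrow> rexp x \<le> rexp y"
  by (cases x; cases y) (auto simp: not_le)

instance
  by standard (auto simp: less_rmax_def less_eq_rmax_iff_rexp rexp_inj simp flip: rexp_inj)

end

text \<open>
  The type-class operations \<open>+\<close>, \<open>*\<close>, \<open>0\<close>, \<open>1\<close> on \<^typ>\<open>rmax\<close> are those of the max-plus
  semiring: \<open>a + b\<close> is the maximum, \<open>a * b\<close> the usual sum of extended reals, \<open>0\<close> is
  \<open>-\<infinity>\<close> and \<open>1\<close> is the real number zero.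
\<close>

instantiation rmax :: comm_semiring_1
begin

definition zero_rmax :: rmax where "0 = MInfty"

definition one_rmax :: rmax where "1 = Fin 0"

definition plus_rmax :: "rmax \<Rightarrow> rmax \<Rightarrow> rmax" where
  "a + b = max a (b :: rmax)"

fun times_rmax :: "rmax \<Rightarrow> rmax \<Rightarrow> rmax" where
  "Fin a * Fin b = Fin (a + b)"
| "MInfty * b = MInfty"
| "Fin a * MInfty = MInfty"

lemma rexp_times: "rexp (x * y) = rexp x * rexp y"
  by (cases x; cases y) (auto simp: exp_add)

lemma rexp_plus: "rexp (x + y) = max (rexp x) (rexp y)"
  by (auto simp: plus_rmax_def max_def less_eq_rmax_iff_rexp)

instance
proof
  fix a b c :: rmax
  show "(a + b) * c = a * c + b * c"
    by (simp add: rexp_times rexp_plus max_mult_distrib_right rexp_nonneg flip: rexp_inj)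
  show "a * b * c = a * (b * c)" "a * b = b * a" "1 * a = a" "0 * a = 0" "a * 0 = 0"
    by (simp_all add: rexp_times one_rmax_def zero_rmax_def mult_ac flip: rexp_inj)
  show "a + b + c = a + (b + c)" "a + b = b + a" "0 + a = a"
    by (simp_all add: rexp_plus zero_rmax_def ac_simps rexp_nonneg flip: rexp_inj)
  show "(0 :: rmax) \<noteq> 1"
    by (simp add: zero_rmax_def one_rmax_def)
qed

end


instantiation rmax :: metric_space
begin

definition dist_rmax :: "rmax \<Rightarrow> rmax \<Rightarrow> real" where
  "dist a b = \<bar>rexp a - rexp b\<bar>"

definition uniformity_rmax :: "(rmax \<times> rmax) filter" where
  "uniformity_rmax = (INF e\<in>{0<..}. principal {(x, y). dist x y < e})"

definition open_rmax :: "rmax set \<Rightarrow> bool" where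
  "open_rmax U \<longleftrightarrow> (\<forall>x\<in>U. \<forall>\<^sub>F (x', y) in uniformity. x' = x \<longrightarrow> y \<in> U)"

instance
  by standard (auto simp: dist_rmax_def uniformity_rmax_def open_rmax_def rexp_inj)

end


section \<open>Max-plus convex cones and polars\<close>

text \<open>
  Semimodules over the max-plus semiring. The class covers both \<open>\<real>\<^sub>m\<^sub>a\<^sub>x\<^sup>n\<close> and
  \<open>(\<real>\<^sub>m\<^sub>a\<^sub>x\<^sup>n)\<^sup>2\<close>, with entrywise operations: \<open>x + y\<close> is the entrywise maximum, and
  \<open>c \<odot> x\<close> adds the scalar \<open>c\<close> to every entry of \<open>x\<close>.
\<close>

class rmax_semimodule = comm_monoid_add +
  fixes rscale :: "rmax \<Rightarrow> 'a \<Rightarrow> 'a"  (infixr \<open>\<odot>\<close> 75)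
  assumes rscale_add_right: "c \<odot> (x + y) = c \<odot> x + c \<odot> y"
    and rscale_add_left: "(c + d) \<odot> x = c \<odot> x + d \<odot> x"
    and rscale_rscale: "c \<odot> d \<odot> x = (c * d) \<odot> x"
    and rscale_one: "1 \<odot> x = x"
    and rscale_zero_left: "0 \<odot> x = 0"
    and rscale_zero_right: "c \<odot> 0 = 0"

instantiation rmax :: rmax_semimodule
begin

definition rscale_rmax :: "rmax \<Rightarrow> rmax \<Rightarrow> rmax" where
  "c \<odot> x = c * (x :: rmax)"

instance
  by standard (simp_all add: rscale_rmax_def algebra_simps)

end

instantiation vec :: (rmax_semimodule, finite) rmax_semimodule
begin

definition rscale_vec :: "rmax \<Rightarrow> 'a ^ 'b \<Rightarrow> 'a ^ 'b" where
  "c \<odot> x = (\<chi> i. c \<odot> x $ i)"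

instance
  by standard (simp_all add: vec_eq_iff rscale_vec_def rscale_add_right rscale_add_left
      rscale_rscale rscale_one rscale_zero_left rscale_zero_right)

end

instantiation prod :: (rmax_semimodule, rmax_semimodule) rmax_semimodule
begin

definition rscale_prod :: "rmax \<Rightarrow> 'a \<times> 'b \<Rightarrow> 'a \<times> 'b" where
  "c \<odot> p = (c \<odot> fst p, c \<odot> snd p)"

instance
  by standard (simp_all add: prod_eq_iff rscale_prod_def rscale_add_right rscale_add_left
      rscale_rscale rscale_one rscale_zero_left rscale_zero_right)

end

definition max_plus_cone :: "'a::rmax_semimodule set \<Rightarrow> bool" where
  "max_plus_cone V \<longleftrightarrow> (\<forall>x\<in>V. \<forall>y\<in>V. \<forall>c d. c \<odot> x + d \<odot> y \<in> V)"

definition polar :: "(rmax ^ 'n) set \<Rightarrow> ((rmax ^ 'n) \<times> (rmax ^ 'n)) set" where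
  "polar V = {(f, g). \<forall>x\<in>V. (MAX i. f $ i * x $ i) \<le> (MAX j. g $ j * x $ j)}"

end

theory Submission
  imports Defs
begin

text \<open>
  For the nontrivial direction, put \<open>V = {x. \<forall>(u, v)\<in>W. u \<cdot> x \<le> v \<cdot> x}\<close> and let \<open>(f, g) \<notin> W\<close>.
  As \<open>W\<close> is closed, \<open>(f, g') \<notin> W\<close> for some \<open>g'\<close> that is strictly larger than \<open>g\<close> in every entry.
  The set \<open>C = {v. (v, g') \<in> W}\<close> is a lower set closed under entrywise maxima, so up to its
  boundary it is the box below its (possibly infinite) supremum \<open>p\<close>. The vector \<open>x = - p\<close>
  then satisfies \<open>v \<cdot> x < 0 \<Longrightarrow> v \<in> C \<Longrightarrow> v \<cdot> x \<le> 0\<close>. By transitivity, \<open>(u, v) \<in> W\<close> and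
  \<open>v \<in> C\<close> imply \<open>u \<in> C\<close>, so homogeneity gives \<open>x \<in> V\<close>, whereas \<open>g \<cdot> x < 0 \<le> f \<cdot> x\<close>.
\<close>

section \<open>The max-plus semiring through the exponential\<close>

lemma less_rmax_iff_rexp: "x < y \<longleftrightarrow> rexp x < rexp y"
  by (auto simp: less_rmax_def less_eq_rmax_iff_rexp)

lemma rexp_one [simp]: "rexp 1 = 1"
  by (simp add: one_rmax_def)

text \<open>Inverse of \<open>rexp\<close> on the nonnegative reals, so that infima and
  perturbations can be computed in the reals and carried back. Negative arguments get the default
  value \<open>MInfty\<close>.\<close>

definition rlog :: "real \<Rightarrow> rmax" where
  "rlog r = (if r \<le> 0 then MInfty else Fin (ln r))"

lemma rexp_rlog [simp]: "0 \<le> r \<Longrightarrow> rexp (rlog r) = r"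
  by (auto simp: rlog_def)

lemma mult_left_mono_rmax: "a \<le> b \<Longrightarrow> c * a \<le> c * (b :: rmax)"
  by (simp add: less_eq_rmax_iff_rexp rexp_times mult_left_mono rexp_nonneg)

lemma continuous_on_rexp: "continuous_on S rexp"
  by (auto simp: continuous_on_iff dist_rmax_def dist_real_def)

section \<open>The max-plus inner product\<close>

definition mp_inner :: "rmax ^ 'n \<Rightarrow> rmax ^ 'n \<Rightarrow> rmax" where
  "mp_inner f x = (MAX i. f $ i * x $ i)"

text \<open>Addition in \<open>rmax\<close> is the maximum. The inner product thus becomes a
  semiring sum, and its linearity follows from distributivity.\<close>

lemma Max_image_eq_sum_rmax:
  fixes h :: "'a \<Rightarrow> rmax"
  assumes "finite A" "A \<noteq> {}"
  shows "Max (h ` A) = sum h A"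
  using assms by (induction rule: finite_ne_induct) (auto simp flip: plus_rmax_def)

lemma mp_inner_eq_sum: "mp_inner f x = (\<Sum>i\<in>UNIV. f $ i * x $ i)"
  by (simp add: mp_inner_def Max_image_eq_sum_rmax)

lemma mp_inner_commute: "mp_inner f x = mp_inner x f"
  by (simp add: mp_inner_def mult.commute)

lemma mp_inner_linear_left:
  "mp_inner (c \<odot> f + d \<odot> g) x = c * mp_inner f x + d * mp_inner g x"
  by (simp add: mp_inner_eq_sum rscale_vec_def rscale_rmax_def distrib_right mult.assoc
      sum.distrib sum_distrib_left)

lemma mp_inner_linear_right:
  "mp_inner x (c \<odot> f + d \<odot> g) = c * mp_inner x f + d * mp_inner x g"
  by (metis mp_inner_commute mp_inner_linear_left)

lemma mp_inner_le_iff: "mp_inner f x \<le> c \<longleftrightarrow> (\<forall>i. f $ i * x $ i \<le> c)"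
  by (auto simp: mp_inner_def)

lemma mp_inner_less_iff: "mp_inner f x < c \<longleftrightarrow> (\<forall>i. f $ i * x $ i < c)"
  by (auto simp: mp_inner_def)

lemma less_mp_inner_iff: "c < mp_inner f x \<longleftrightarrow> (\<exists>i. c < f $ i * x $ i)"
  by (simp add: mp_inner_le_iff flip: not_le)

lemma le_mp_inner_iff: "c \<le> mp_inner f x \<longleftrightarrow> (\<exists>i. c \<le> f $ i * x $ i)"
  by (simp add: mp_inner_less_iff flip: not_less)

lemma mp_inner_le_mp_inner_iff:
  "mp_inner f x \<le> mp_inner g x \<longleftrightarrow> (\<forall>i. \<exists>j. f $ i * x $ i \<le> g $ j * x $ j)"
  by (subst mp_inner_le_iff) (simp add: le_mp_inner_iff)

lemma mp_inner_mono_left: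
  assumes "f \<le> g"
  shows "mp_inner f x \<le> mp_inner g x"
proof -
  have "f $ i * x $ i \<le> g $ i * x $ i" for i
    using assms mult_left_mono_rmax[of "f $ i" "g $ i" "x $ i"]
    by (simp add: less_eq_vec_def mult.commute)
  then show ?thesis
    by (auto simp: mp_inner_le_mp_inner_iff)
qed

lemma linear_combination_mono_rmax:
  fixes c :: rmax
  assumes "a \<le> a'" "b \<le> b'"
  shows "c * a + d * b \<le> c * a' + d * b'"
  unfolding plus_rmax_def by (intro max.mono mult_left_mono_rmax assms)

lemma mem_polar_iff: "(f, g) \<in> polar V \<longleftrightarrow> (\<forall>x\<in>V. mp_inner f x \<le> mp_inner g x)"
  by (simp add: polar_def mp_inner_def)

section \<open>Properties of polars\<close>

lemma max_plus_cone_polar: "max_plus_cone (polar V)"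
  by (auto simp: max_plus_cone_def mem_polar_iff rscale_prod_def mp_inner_linear_left
      intro!: linear_combination_mono_rmax)

text \<open>After exponentiation, comparing two single terms is a closed condition. One maximum is
  below another iff each \<open>i\<close> has a suitable \<open>j\<close>, and the union over
  \<open>j\<close> stays closed because it is finite.\<close>

lemma closed_polar: "closed (polar (V :: (rmax ^ 'n) set))"
proof -
  have mp_inner_le: "mp_inner f x \<le> mp_inner g x \<longleftrightarrow>
      (\<forall>i. \<exists>j. rexp (f $ i) * rexp (x $ i) \<le> rexp (g $ j) * rexp (x $ j))" for f g x :: "rmax ^ 'n"
    unfolding mp_inner_le_mp_inner_iff by (simp add: less_eq_rmax_iff_rexp rexp_times)
  have "closed {p :: (rmax ^ 'n) \<times> (rmax ^ 'n).
      rexp (fst p $ i) * rexp (x $ i) \<le> rexp (snd p $ j) * rexp (x $ j)}" for x :: "rmax ^ 'n" and i j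
    by (intro closed_Collect_le continuous_intros continuous_on_compose2[OF continuous_on_rexp[of UNIV]])
       auto
  then have "closed (\<Inter>x\<in>V. \<Inter>i. \<Union>j. {p :: (rmax ^ 'n) \<times> (rmax ^ 'n).
      rexp (fst p $ i) * rexp (x $ i) \<le> rexp (snd p $ j) * rexp (x $ j)})"
    by (intro closed_INT ballI closed_UN) auto
  also have "(\<Inter>x\<in>V. \<Inter>i. \<Union>j. {p :: (rmax ^ 'n) \<times> (rmax ^ 'n).
      rexp (fst p $ i) * rexp (x $ i) \<le> rexp (snd p $ j) * rexp (x $ j)}) = polar V"
    by (auto simp: mem_polar_iff mp_inner_le)
  finally show ?thesis .
qed

section \<open>Separation\<close>

lemma max_plus_cone_add:
  assumes "max_plus_cone V" "x \<in> V" "y \<in> V"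
  shows "x + y \<in> V"
  using assms(1)[unfolded max_plus_cone_def, rule_format, OF assms(2,3), of 1 1]
  by (simp add: rscale_one)

lemma max_plus_cone_scale:
  assumes "max_plus_cone V" "x \<in> V"
  shows "c \<odot> x \<in> V"
  using assms(1)[unfolded max_plus_cone_def, rule_format, OF assms(2,2), of c 0]
  by (simp add: rscale_zero_left)

text \<open>A separate witness for each coordinate suffices: addition is idempotent on
  \<open>g\<close>, so the maximum of finitely many witnesses is still related to \<open>g\<close>.
  It dominates \<open>v\<close>, and transitivity concludes.\<close>

lemma max_plus_cone_join:
  fixes W :: "((rmax ^ 'n) \<times> (rmax ^ 'n)) set"
  assumes cone: "max_plus_cone W" and mono: "\<forall>f g. f \<le> g \<longrightarrow> (f, g) \<in> W"
    and trans: "\<forall>f g h. (f, g) \<in> W \<and> (g, h) \<in> W \<longrightarrow> (f, h) \<in> W"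
    and ex: "\<And>j. \<exists>w. (w, g) \<in> W \<and> v $ j \<le> w $ j"
  shows "(v, g) \<in> W"
proof -
  have "\<exists>w. (w, g) \<in> W \<and> (\<forall>j\<in>A. v $ j \<le> w $ j)" if "finite A" for A :: "'n set"
    using that
  proof (induction A)
    case empty
    show ?case using mono by auto
  next
    case (insert j A)
    then obtain w w' where w: "(w, g) \<in> W" "\<forall>j\<in>A. v $ j \<le> w $ j" "(w', g) \<in> W" "v $ j \<le> w' $ j"
      using ex by blast
    moreover have "g + g = g"
      by (simp add: vec_eq_iff plus_rmax_def)
    ultimately have "(w + w', g) \<in> W"
      using max_plus_cone_add[OF cone, of "(w, g)" "(w', g)"] by simp
    moreover have "\<forall>k\<in>insert j A. v $ k \<le> (w + w') $ k"
      using w by (auto simp: plus_rmax_def le_max_iff_disj)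
    ultimately show ?case by blast
  qed
  from this[of UNIV] obtain w where "(w, g) \<in> W" "v \<le> w"
    by (auto simp: less_eq_vec_def)
  then show ?thesis
    using mono trans by blast
qed

text \<open>The first bound is strict and the second is not, because the supremum of the vectors
  related to \<open>g\<close> need not be attained.\<close>

lemma exists_separating_vector:
  fixes W :: "((rmax ^ 'n) \<times> (rmax ^ 'n)) set"
  assumes cone: "max_plus_cone W" and mono: "\<forall>f g. f \<le> g \<longrightarrow> (f, g) \<in> W"
    and trans: "\<forall>f g h. (f, g) \<in> W \<and> (g, h) \<in> W \<longrightarrow> (f, h) \<in> W"
    and g: "\<And>i. 0 < rexp (g $ i)"
  obtains x where "\<And>v. mp_inner v x < 1 \<Longrightarrow> (v, g) \<in> W" "\<And>v. (v, g) \<in> W \<Longrightarrow> mp_inner v x \<le> 1"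
    "\<And>u v. (u, v) \<in> W \<Longrightarrow> mp_inner u x \<le> mp_inner v x"
proof -
  \<comment> \<open>An infimum of inverses replaces the inverse of a supremum: where the supremum is
    infinite, the infimum is 0 and \<open>x $ j\<close> becomes \<open>MInfty\<close>. Zero entries
    are excluded since \<open>inverse 0 = 0\<close> would spoil the infimum. Positivity of
    \<open>g\<close> makes \<open>S j\<close> nonempty, with \<open>g\<close> itself as a
    member.\<close>
  define S where "S j = (\<lambda>p. inverse (rexp (p $ j))) ` {p. (p, g) \<in> W \<and> 0 < rexp (p $ j)}" for j
  have S_ne: "S j \<noteq> {}" for j
    using mono g by (auto simp: S_def)
  have S_nonneg: "0 \<le> s" if "s \<in> S j" for s j
    using that by (auto simp: S_def rexp_nonneg)
  then have S_bdd: "bdd_below (S j)" for j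
    by (meson bdd_belowI)
  define x where "x = (\<chi> j. rlog (Inf (S j)))"
  have rexp_x: "rexp (x $ j) = Inf (S j)" for j
    using S_nonneg S_ne by (auto simp: x_def intro!: rexp_rlog cInf_greatest)
  have below: "(v, g) \<in> W" if "mp_inner v x < 1" for v
  proof (rule max_plus_cone_join[OF cone mono trans])
    fix j
    show "\<exists>w. (w, g) \<in> W \<and> v $ j \<le> w $ j"
    proof (cases "0 < rexp (v $ j)")
      case True
      have "rexp (v $ j) * Inf (S j) < 1"
        using that unfolding mp_inner_less_iff by (simp add: less_rmax_iff_rexp rexp_times rexp_x)
      then have "Inf (S j) < inverse (rexp (v $ j))"
        using True by (simp add: field_simps)
      then obtain p where "(p, g) \<in> W" "0 < rexp (p $ j)" "inverse (rexp (p $ j)) < inverse (rexp (v $ j))"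
        using cInf_lessD[OF S_ne] by (auto simp: S_def)
      then show ?thesis
        using True by (auto simp: less_eq_rmax_iff_rexp)
    next
      \<comment> \<open>Here \<open>v $ j\<close> is \<open>MInfty\<close>, so \<open>g\<close>
        serves as the witness.\<close>
      case False
      then have "v $ j \<le> g $ j"
        using rexp_nonneg[of "g $ j"] by (simp add: less_eq_rmax_iff_rexp)
      then show ?thesis
        using mono by blast
    qed
  qed
  have above: "mp_inner v x \<le> 1" if "(v, g) \<in> W" for v
    unfolding mp_inner_le_iff
  proof
    fix j
    show "v $ j * x $ j \<le> 1"
    proof (cases "0 < rexp (v $ j)")
      case True
      then have "Inf (S j) \<le> inverse (rexp (v $ j))"
        using that by (intro cInf_lower S_bdd) (auto simp: S_def)
      then show ?thesis
        using True by (simp add: less_eq_rmax_iff_rexp rexp_times rexp_x field_simps)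
    next
      case False
      then show ?thesis
        using rexp_nonneg[of "v $ j"] by (simp add: less_eq_rmax_iff_rexp rexp_times)
    qed
  qed
  have "mp_inner u x \<le> mp_inner v x" if uv: "(u, v) \<in> W" for u v
  proof (rule ccontr)
    assume "\<not> ?thesis"
    \<comment> \<open>Scaling by the inverse of a level \<open>r\<close> strictly inside the gap
      moves \<open>v\<close> strictly below 1, where \<open>below\<close> applies, and
      \<open>u\<close> strictly above 1. Transitivity then relates the scaled \<open>u\<close> to
      \<open>g\<close>, against \<open>above\<close>.\<close>
    then obtain r where r: "rexp (mp_inner v x) < r" "r < rexp (mp_inner u x)"
      using dense by (auto simp: not_le less_rmax_iff_rexp)
    then have r_pos: "0 < r"
      using rexp_nonneg le_less_trans by blast
    define c where "c = rlog (inverse r)"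
    have scale: "rexp (mp_inner (c \<odot> w) x) = inverse r * rexp (mp_inner w x)" for w
      using mp_inner_linear_left[of c w 0 w x] r_pos
      by (simp add: c_def rscale_zero_left rexp_times)
    have "mp_inner (c \<odot> v) x < 1" "1 < mp_inner (c \<odot> u) x"
      using r r_pos by (simp_all add: less_rmax_iff_rexp scale field_simps)
    moreover have "(c \<odot> u, c \<odot> v) \<in> W"
      using max_plus_cone_scale[OF cone uv, of c] by (simp add: rscale_prod_def)
    ultimately show False
      using below above trans by (meson not_le)
  qed
  with below above show thesis
    by (rule that)
qed

lemma closed_perturb_right:
  fixes W :: "((rmax ^ 'n) \<times> (rmax ^ 'n)) set"
  assumes "closed W" "(f, g) \<notin> W"
  obtains g' where "(f, g') \<notin> W" "\<And>i. g $ i < g' $ i"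
proof -
  \<comment> \<open>The increment is added after exponentiation, so that entries equal to
    \<open>MInfty\<close> also increase strictly, while \<open>G n\<close> still converges to
    \<open>g\<close> in the metric.\<close>
  define G where "G n = (\<chi> i. rlog (rexp (g $ i) + inverse (real (Suc n))))" for n
  have rexp_G: "rexp (G n $ i) = rexp (g $ i) + inverse (real (Suc n))" for n i
    by (simp add: G_def rexp_nonneg del: of_nat_Suc)
  have "(\<lambda>n. G n $ i) \<longlonglongrightarrow> g $ i" for i
    using LIMSEQ_inverse_real_of_nat
    by (subst tendsto_dist_iff) (simp add: dist_rmax_def rexp_G del: of_nat_Suc)
  then have "G \<longlonglongrightarrow> g"
    by (rule vec_tendstoI)
  then have "(\<lambda>n. (f, G n)) \<longlonglongrightarrow> (f, g)"
    by (intro tendsto_intros)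
  then obtain n where "(f, G n) \<notin> W"
    using assms closed_sequentially[OF assms(1), of "\<lambda>n. (f, G n)"] by auto
  moreover have "g $ i < G n $ i" for i
    by (simp add: less_rmax_iff_rexp rexp_G del: of_nat_Suc)
  ultimately show thesis
    by (rule that)
qed

theorem theorem1:
  fixes W :: "((rmax ^ 'n) \<times> (rmax ^ 'n)) set"
  shows "(\<exists>V :: (rmax ^ 'n) set. max_plus_cone V \<and> W = polar V) \<longleftrightarrow>
    (closed W \<and> max_plus_cone W) \<and>
    (\<forall>f g :: rmax ^ 'n. f \<le> g \<longrightarrow> (f, g) \<in> W) \<and>
    (\<forall>f g h :: rmax ^ 'n. (f, g) \<in> W \<and> (g, h) \<in> W \<longrightarrow> (f, h) \<in> W)"
proof (intro iffI)
  assume "\<exists>V :: (rmax ^ 'n) set. max_plus_cone V \<and> W = polar V"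
  then obtain V :: "(rmax ^ 'n) set" where W: "W = polar V"
    by blast
  show "(closed W \<and> max_plus_cone W) \<and>
    (\<forall>f g :: rmax ^ 'n. f \<le> g \<longrightarrow> (f, g) \<in> W) \<and>
    (\<forall>f g h :: rmax ^ 'n. (f, g) \<in> W \<and> (g, h) \<in> W \<longrightarrow> (f, h) \<in> W)"
    unfolding W using closed_polar max_plus_cone_polar
    by (auto simp: mem_polar_iff mp_inner_mono_left intro: order_trans)
next
  assume "(closed W \<and> max_plus_cone W) \<and>
    (\<forall>f g :: rmax ^ 'n. f \<le> g \<longrightarrow> (f, g) \<in> W) \<and>
    (\<forall>f g h :: rmax ^ 'n. (f, g) \<in> W \<and> (g, h) \<in> W \<longrightarrow> (f, h) \<in> W)"
  then have closed: "closed W" and cone: "max_plus_cone W"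
    and mono: "\<forall>f g. f \<le> g \<longrightarrow> (f, g) \<in> W"
    and trans: "\<forall>f g h. (f, g) \<in> W \<and> (g, h) \<in> W \<longrightarrow> (f, h) \<in> W"
    by blast+
  \<comment> \<open>The largest set on which all inequalities in \<open>W\<close> hold; only the
    inclusion of \<open>polar V\<close> in \<open>W\<close> needs separation.\<close>
  define V where "V = {x. \<forall>(f, g)\<in>W. mp_inner f x \<le> mp_inner g x}"
  have "max_plus_cone V"
    by (auto simp: max_plus_cone_def V_def mp_inner_linear_right intro!: linear_combination_mono_rmax)
  moreover have "W \<subseteq> polar V"
    by (auto simp: mem_polar_iff V_def)
  moreover have "(f, g) \<in> W" if fg: "(f, g) \<in> polar V" for f g
  proof (rule ccontr)
    assume "(f, g) \<notin> W"
    with closed obtain g' where g': "(f, g') \<notin> W" "\<And>i. g $ i < g' $ i"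
      using closed_perturb_right by blast
    have g'_pos: "0 < rexp (g' $ i)" for i
      using g'(2)[of i] rexp_nonneg[of "g $ i"] by (simp add: less_rmax_iff_rexp)
    obtain x where below: "\<And>v. mp_inner v x < 1 \<Longrightarrow> (v, g') \<in> W"
      and above: "\<And>v. (v, g') \<in> W \<Longrightarrow> mp_inner v x \<le> 1"
      and x: "\<And>u v. (u, v) \<in> W \<Longrightarrow> mp_inner u x \<le> mp_inner v x"
      using exists_separating_vector[OF cone mono trans g'_pos] by blast
    have "mp_inner g x < 1"
      unfolding mp_inner_less_iff
    proof
      fix i
      \<comment> \<open>Reflexivity puts \<open>(g', g')\<close> in \<open>W\<close>, so
        \<open>above\<close> applies to \<open>g'\<close>. The strict gap between \<open>g\<close>
        and \<open>g'\<close> then makes the bound for \<open>g\<close> strict.\<close>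
      have le: "rexp (g' $ i) * rexp (x $ i) \<le> 1"
        using above[of g'] mono unfolding mp_inner_le_iff
        by (simp add: less_eq_rmax_iff_rexp rexp_times)
      have "rexp (g $ i) * rexp (x $ i) < 1"
      proof (cases "rexp (x $ i) = 0")
        case False
        then have "rexp (g $ i) * rexp (x $ i) < rexp (g' $ i) * rexp (x $ i)"
          using g'(2)[of i] rexp_nonneg[of "x $ i"] by (simp add: less_rmax_iff_rexp)
        with le show ?thesis by simp
      qed simp
      then show "g $ i * x $ i < 1"
        by (simp add: less_rmax_iff_rexp rexp_times)
    qed
    also have "1 \<le> mp_inner f x"
      using below g'(1) by (meson not_le)
    also have "\<dots> \<le> mp_inner g x"
      using fg x by (auto simp: mem_polar_iff V_def)
    finally show False by simp
  qed
  ultimately show "\<exists>V :: (rmax ^ 'n) set. max_plus_cone V \<and> W = polar V"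
    by (metis subrelI subset_antisym)
qed

end
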